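(* Let $d\in\mathbb{N}$, $d\ge 3$, let $\omega_1,\omega_2,\ldots$ be i.i.d. random variables uniformly distributed on $[0,\frac{2\pi}{d}]$, and for each $n\in\mathbb{N}$ write $\mathcal{D}^d_n(\omega)=\mathcal{D}^d_n(\omega_1,\ldots,\omega_n)$. Then there exists $C_d>0$ such that for any $\theta\in[0,\pi]$, $$\mathbb{E}_{\omega}\Big|\mathrm{Proj}_{\theta}\,\mathcal{D}^d_n(\omega)\Big|\le \frac{C_d}{n}\quad\text{for all } n\in\mathbb{N}.$$ Consequently, $$\mathbb{E}_{\omega}\big[\mathrm{Fav}(\mathcal{D}^d_n(\omega))\big]\le \frac{C_d}{n}\quad\text{for all } n\in\mathbb{N},$$ and, almost surely, $$\liminf_{n\to\infty}\ n\cdot \mathrm{Fav}(\mathcal{D}^d_n(\omega))<\infty .$$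
   Context: Notation. For $A\subset\mathbb{R}$ (or a subset of a line) measurable, $|A|$ is its one-dimensional Lebesgue measure. For $\theta\in[0,\pi]$, $\mathrm{Proj}_\theta$ is the orthogonal projection of the plane $\mathbb{C}$ onto the line through the origin having angle $\theta$ with the real axis. The Favard length of a planar set $E\subset\mathbb{C}$ is $$\mathrm{Fav}(E)=\frac1\pi\int_0^\pi \big|\mathrm{Proj}_\theta E\big|\,d\theta .$$ Construction of $\mathcal{D}^d_n$. Let $d\ge3$ be an integer and let $\mathcal{D}^d_0=\{z\in\mathbb{C}:|z|\le 1\}$. For $\alpha\in[0,\frac{2\pi}{d}]$ and $j\in\{0,1,\ldots,d-1\}$ let $S_j^{\alpha}(z)=\frac1d z+\frac{d-1}{d} e^{i(\frac{2\pi}{d}j-\alpha)}$. Set $\mathcal{D}^d_1(\omega_1)=\bigcup_{j=0}^{d-1}S_j^{\omega_1}(\mathcal{D}^d_0)$. Inductively, $\mathcal{D}^d_k(\omega_1,\ldots,\omega_k)$ is obtained from $\mathcal{D}^d_{k-1}(\omega_1,\ldots,\omega_{k-1})$, a union of $d^{k-1}$ disks of radius $d^{-k+1}$, by replacing each of these disks by the translate, to the center of that disk, of the set $\bigcup_{j=0}^{d-1}\frac{1}{d^{k-1}}S_j^{\omega_k}(\mathcal{D}^d_0)$. Equivalently, $\mathcal{D}^d_k(\omega_1,\ldots,\omega_k)$ is the union, over all $(j_1,\ldots,j_k)\in\{0,\ldots,d-1\}^k$, of the closed disks of radius $d^{-k}$ centered at $\sum_{m=1}^k \frac{d-1}{d}\,d^{-(m-1)}e^{i(\frac{2\pi}{d}j_m-\omega_m)}$,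 where $i=\sqrt{-1}$. $\mathbb{E}_\omega$ denotes expectation with respect to the random variables $\omega_1,\omega_2,\ldots$. *)

theory Defs
  imports "HOL-Probability.Probability"
begin

section \<open>Projections and Favard length\<close>

definition Proj :: "real \<Rightarrow> complex \<Rightarrow> complex" where
  "Proj \<theta> z = (z \<bullet> cis \<theta>) *\<^sub>R cis \<theta>"

lemma Proj_in_line: "Proj \<theta> z \<in> span {cis \<theta>}"
  by (simp add: Proj_def span_base span_scale)

lemma Proj_orthogonal:
  assumes "v \<in> span {cis \<theta>}"
  shows "orthogonal (z - Proj \<theta> z) v"
proof -
  have "cis \<theta> \<bullet> cis \<theta> = 1" by (simp add: dot_square_norm)
  moreover obtain k where "v = k *\<^sub>R cis \<theta>"
    using assms by (auto simp: span_singleton)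
  ultimately show ?thesis
    by (simp only: Proj_def orthogonal_def inner_diff_left inner_scaleR_left inner_scaleR_right)
      simp
qed

text \<open>
  The length of a subset of the line \<open>span {cis \<theta>}\<close>: its Lebesgue measure in the
  arc length parametrisation \<open>t \<mapsto> t *\<^sub>R cis \<theta>\<close>.
\<close>

definition line_length :: "real \<Rightarrow> complex set \<Rightarrow> real" where
  "line_length \<theta> A = measure lebesgue {t. t *\<^sub>R cis \<theta> \<in> A}"

definition Fav :: "complex set \<Rightarrow> real" where
  "Fav E = 1 / pi * (LINT \<theta>:{0..pi}|lebesgue. line_length \<theta> (Proj \<theta> ` E))"

section \<open>Random disk-like Cantor sets\<close>

definition S :: "nat \<Rightarrow> nat \<Rightarrow> real \<Rightarrow> complex \<Rightarrow> complex" where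
  "S d j \<alpha> z = of_real (1 / real d) * z
     + of_real ((real d - 1) / real d) * cis (2 * pi / real d * real j - \<alpha>)"

definition D0 :: "complex set" where
  "D0 = cball 0 1"

text \<open>
  The angles are \<open>w 1, w 2, \<dots>\<close>; the value \<open>w 0\<close> is never used. \<open>centers d w k\<close> is the set of
  centers of the disks of radius \<open>1 / d ^ k\<close> that make up \<open>D d w k\<close>.
\<close>

primrec centers :: "nat \<Rightarrow> (nat \<Rightarrow> real) \<Rightarrow> nat \<Rightarrow> complex set" where
  "centers d w 0 = {0}"
| "centers d w (Suc k) =
     (\<Union>c\<in>centers d w k. \<Union>j<d. {c + of_real (1 / real d ^ k) * S d j (w (Suc k)) 0})"

primrec D :: "nat \<Rightarrow> (nat \<Rightarrow> real) \<Rightarrow> nat \<Rightarrow> complex set" where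
  "D d w 0 = D0"
| "D d w (Suc k) =
     (\<Union>c\<in>centers d w k.
        (\<lambda>z. c + z) ` (\<Union>j<d. (\<lambda>z. of_real (1 / real d ^ k) * z) ` S d j (w (Suc k)) ` D0))"

lemma image_cball_complex:
  fixes a :: complex
  assumes "r > 0"
  shows "(\<lambda>z. a + of_real r * z) ` cball 0 1 = cball a r"
proof -
  have "(\<lambda>z. a + of_real r * z) ` cball 0 1 = (+) a ` ((*\<^sub>R) r ` cball 0 1)"
    by (simp add: image_image scaleR_conv_of_real)
  also have "\<dots> = cball a r"
  proof -
    have "(*\<^sub>R) r ` cball (0::complex) 1 = cball 0 r"
      using cball_scale[of r 0 1] assms by simp
    moreover have "(+) a ` cball 0 r = cball a r"
      using cball_translation[of a 0 r] by (simp only: add_0_right)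
    ultimately show ?thesis by (simp only:)
  qed
  finally show ?thesis .
qed

lemma D_eq_disks:
  assumes "d > 0"
  shows "D d w k = (\<Union>c\<in>centers d w k. cball c (1 / real d ^ k))"
proof (cases k)
  case 0
  then show ?thesis by (simp add: D0_def)
next
  case (Suc m)
  have "(\<lambda>z. c + z) ` (\<lambda>z. of_real (1 / real d ^ m) * z) ` S d j \<alpha> ` D0
      = cball (c + of_real (1 / real d ^ m) * S d j \<alpha> 0) (1 / real d ^ Suc m)" for c j \<alpha>
  proof -
    have "c + of_real (1 / real d ^ m) * S d j \<alpha> z
        = (c + of_real (1 / real d ^ m) * S d j \<alpha> 0) + of_real (1 / real d ^ Suc m) * z" for z
      by (simp add: S_def distrib_left)
    then have "(\<lambda>z. c + z) ` (\<lambda>z. of_real (1 / real d ^ m) * z) ` S d j \<alpha> ` D0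
        = (\<lambda>z. (c + of_real (1 / real d ^ m) * S d j \<alpha> 0)
            + of_real (1 / real d ^ Suc m) * z) ` cball 0 1"
      unfolding image_image D0_def by (intro image_cong refl)
    also have "\<dots> = cball (c + of_real (1 / real d ^ m) * S d j \<alpha> 0) (1 / real d ^ Suc m)"
      using assms by (intro image_cball_complex) simp
    finally show ?thesis .
  qed
  then show ?thesis
    unfolding Suc D.simps centers.simps image_UN by auto
qed

lemma centers_eq:
  "centers d w k =
     (\<lambda>j. \<Sum>m=1..k. of_real ((real d - 1) / real d * (1 / real d ^ (m - 1)))
            * cis (2 * pi / real d * real (j m) - w m)) ` ({1..k} \<rightarrow>\<^sub>E {..<d})"
proof (induction k)
  case 0
  then show ?case by simp
next
  case (Suc k)
  let ?g = "\<lambda>m i. complex_of_real ((real d - 1) / real d * (1 / real d ^ (m - 1)))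
            * cis (2 * pi / real d * real (i::nat) - w m)"
  have img: "(\<lambda>(i, f). F f + G i) ` (A \<times> B) = (\<Union>c\<in>F ` B. \<Union>i\<in>A. {c + G i})"
    for F :: "(nat \<Rightarrow> nat) \<Rightarrow> complex" and G :: "nat \<Rightarrow> complex" and A B
    by fast
  have ins: "{1..Suc k} = insert (Suc k) {1..k}" by auto
  have step: "(\<Sum>m=1..Suc k. ?g m ((f(Suc k := i)) m)) = (\<Sum>m=1..k. ?g m (f m)) + ?g (Suc k) i"
    for f i
  proof -
    have "(\<Sum>m=1..k. ?g m ((f(Suc k := i)) m)) = (\<Sum>m=1..k. ?g m (f m))"
      by (rule sum.cong) auto
    then show ?thesis by (simp add: ins)
  qed
  have "(\<lambda>j. \<Sum>m=1..Suc k. ?g m (j m)) ` ({1..Suc k} \<rightarrow>\<^sub>E {..<d})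
      = (\<lambda>(i, f). \<Sum>m=1..Suc k. ?g m ((f(Suc k := i)) m)) ` ({..<d} \<times> ({1..k} \<rightarrow>\<^sub>E {..<d}))"
    unfolding ins PiE_insert_eq by (simp add: image_image case_prod_unfold)
  also have "\<dots> = (\<lambda>(i, f). (\<Sum>m=1..k. ?g m (f m)) + ?g (Suc k) i) ` ({..<d} \<times> ({1..k} \<rightarrow>\<^sub>E {..<d}))"
    by (simp only: step)
  also have "\<dots> = (\<Union>c\<in>(\<lambda>f. \<Sum>m=1..k. ?g m (f m)) ` ({1..k} \<rightarrow>\<^sub>E {..<d}).
      \<Union>i<d. {c + ?g (Suc k) i})"
    by (rule img)
  also have "\<dots> = centers d w (Suc k)"
    unfolding centers.simps Suc.IH [symmetric] by (simp add: S_def mult.commute)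
  finally show ?case by (rule sym)
qed

end

theory Submission
  imports Defs
begin

text \<open>
  Let \<open>L\<^sub>n\<close> be the length of the projection of the \<open>n\<close>-th set in direction \<open>\<theta>\<close>. Conditioning on
  \<open>\<omega>\<^sub>2, \<omega>\<^sub>3, \<dots>\<close> fixes the projection \<open>A\<close> of the next generations, and the projection of the
  \<open>(n+1)\<close>-st set is a union of \<open>d\<close> translates of \<open>A / d\<close>. Two adjacent translates are displaced, at the
  scale of \<open>A\<close>, by \<open>R sin v\<close> with \<open>R \<ge> 2\<close>, where \<open>v\<close> sweeps the whole circle uniformly as \<open>\<omega>\<^sub>1\<close> and
  the pair of neighbours vary. Since \<open>A\<close> has diameter at most 2, the average of
  \<open>\<bar>A \<inter> (A + R sin v)\<bar>\<close> over \<open>v\<close> is at least a constant times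
  \<open>\<integral> \<bar>A \<inter> (A + s)\<bar> ds = \<bar>A\<bar>\<^sup>2\<close>. Counting this overlap once gives the recursion
  \<open>E L\<^sub>n\<^sub>+\<^sub>1 \<le> E L\<^sub>n - c E L\<^sub>n\<^sup>2 \<le> E L\<^sub>n - c (E L\<^sub>n)\<^sup>2\<close>, whose solutions decay like \<open>1 / n\<close>. The bounds on the
  Favard length follow from Fubini's theorem and Fatou's lemma.
\<close>

section \<open>Shadows\<close>

text \<open>Arc length identifies the line with the reals, so a projection becomes a set of reals
  and its length is plain Lebesgue measure.\<close>

definition shadow :: "nat \<Rightarrow> real \<Rightarrow> (nat \<Rightarrow> real) \<Rightarrow> nat \<Rightarrow> real set" where
  "shadow d \<theta> w n = (\<lambda>z. z \<bullet> cis \<theta>) ` D d w n"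

text \<open>Coordinate along \<open>cis \<theta>\<close> of the \<open>j\<close>-th center of the
  first generation; see \<open>inner_S_zero\<close>.\<close>

definition offset :: "nat \<Rightarrow> real \<Rightarrow> real \<Rightarrow> nat \<Rightarrow> real" where
  "offset d \<theta> u j = (real d - 1) / real d * cos (2 * pi / real d * real j - u - \<theta>)"

lemma line_length_Proj: "line_length \<theta> (Proj \<theta> ` E) = measure lebesgue ((\<lambda>z. z \<bullet> cis \<theta>) ` E)"
proof -
  have "{t. t *\<^sub>R cis \<theta> \<in> Proj \<theta> ` E} = (\<lambda>z. z \<bullet> cis \<theta>) ` E"
    by (auto simp: Proj_def image_iff)
  then show ?thesis by (simp add: line_length_def)
qed

lemma inner_cis_image_cball:
  assumes "0 \<le> r"
  shows "(\<lambda>z. z \<bullet> cis \<theta>) ` cball c r = {c \<bullet> cis \<theta> - r .. c \<bullet> cis \<theta> + r}"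
proof (intro equalityI subsetI)
  fix t assume "t \<in> (\<lambda>z. z \<bullet> cis \<theta>) ` cball c r"
  then obtain z where z: "dist c z \<le> r" "t = z \<bullet> cis \<theta>" by auto
  have "\<bar>(z - c) \<bullet> cis \<theta>\<bar> \<le> norm (z - c) * norm (cis \<theta>)" by (rule Cauchy_Schwarz_ineq2)
  with z show "t \<in> {c \<bullet> cis \<theta> - r .. c \<bullet> cis \<theta> + r}"
    by (simp add: dist_norm norm_minus_commute inner_diff_left abs_le_iff)
next
  fix t assume t: "t \<in> {c \<bullet> cis \<theta> - r .. c \<bullet> cis \<theta> + r}"
  \<comment> \<open>The preimage is taken on the diameter parallel to
    \<open>cis \<theta>\<close>.\<close>
  let ?z = "c + (t - c \<bullet> cis \<theta>) *\<^sub>R cis \<theta>"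
  have "cis \<theta> \<bullet> cis \<theta> = 1" by (simp add: dot_square_norm)
  then have "?z \<bullet> cis \<theta> = t" by (simp only: inner_add_left inner_scaleR_left) simp
  moreover have "?z \<in> cball c r" using t by (auto simp: dist_norm abs_le_iff)
  ultimately show "t \<in> (\<lambda>z. z \<bullet> cis \<theta>) ` cball c r" by (metis imageI)
qed

lemma finite_centers: "finite (centers d w n)"
  by (induction n) auto

text \<open>\<open>centers\<close> appends the finest generation last, whereas the recursion for the
  expected length peels off the first angle. Self-similarity reconciles the two: the outer
  similarity is carried through the last generation.\<close>

lemma centers_Suc_shift:
  "centers d w (Suc k) =
     (\<Union>j<d. (\<lambda>z. S d j (w 1) 0 + of_real (1 / real d) * z) ` centers d (\<lambda>m. w (Suc m)) k)"
proof (induction k)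
  case 0
  then show ?case by simp
next
  case (Suc k)
  have "centers d w (Suc (Suc k)) = (\<Union>c\<in>centers d w (Suc k). \<Union>i<d.
          {c + of_real (1 / real d ^ Suc k) * S d i (w (Suc (Suc k))) 0})"
    by (rule centers.simps)
  also have "\<dots> = (\<Union>j<d. \<Union>c\<in>centers d (\<lambda>m. w (Suc m)) k. \<Union>i<d.
      {S d j (w 1) 0 + of_real (1 / real d) * (c + of_real (1 / real d ^ k) * S d i (w (Suc (Suc k))) 0)})"
    unfolding Suc.IH by (simp add: distrib_left add.assoc)
  also have "\<dots> = (\<Union>j<d. (\<lambda>z. S d j (w 1) 0 + of_real (1 / real d) * z) `
      centers d (\<lambda>m. w (Suc m)) (Suc k))"
    unfolding centers.simps by blast
  finally show ?case .
qed

lemma inner_S_zero: "S d j u 0 \<bullet> cis \<theta> = offset d \<theta> u j"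
  by (simp add: S_def offset_def inner_complex_def cos_diff[of _ \<theta>] distrib_left
      del: of_real_divide of_real_diff)

lemma shadow_eq_intervals:
  assumes "d > 0"
  shows "shadow d \<theta> w n =
    (\<Union>c\<in>centers d w n. {c \<bullet> cis \<theta> - 1 / real d ^ n .. c \<bullet> cis \<theta> + 1 / real d ^ n})"
  unfolding shadow_def D_eq_disks[OF assms] image_UN
  by (intro SUP_cong refl inner_cis_image_cball) simp

lemma shadow_0: "shadow d \<theta> w 0 = {-1..1}"
  using inner_cis_image_cball[of 1 \<theta> 0] by (simp add: shadow_def D0_def)

text \<open>Undoing the similarity in the point \<open>t\<close> leaves finitely many membership
  conditions one generation lower, a form in which measurability can be proved by induction.\<close>

lemma mem_shadow_Suc:
  assumes d: "d > 0"
  shows "t \<in> shadow d \<theta> w (Suc n) \<longleftrightarrow>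
    (\<exists>j\<in>{..<d}. real d * (t - offset d \<theta> (w 1) j) \<in> shadow d \<theta> (\<lambda>m. w (Suc m)) n)"
proof -
  have "t \<in> {(S d j (w 1) 0 + of_real (1 / real d) * c) \<bullet> cis \<theta> - 1 / real d ^ Suc n ..
             (S d j (w 1) 0 + of_real (1 / real d) * c) \<bullet> cis \<theta> + 1 / real d ^ Suc n} \<longleftrightarrow>
      real d * (t - offset d \<theta> (w 1) j)
        \<in> {c \<bullet> cis \<theta> - 1 / real d ^ n .. c \<bullet> cis \<theta> + 1 / real d ^ n}" for c j
  proof -
    have "(of_real (1 / real d) * c) \<bullet> cis \<theta> = (c \<bullet> cis \<theta>) / real d"
      by (metis inner_scaleR_left scaleR_conv_of_real mult.commute times_divide_eq_right mult_1_right)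
    then have e: "(S d j (w 1) 0 + of_real (1 / real d) * c) \<bullet> cis \<theta>
        = offset d \<theta> (w 1) j + (c \<bullet> cis \<theta>) / real d"
      by (simp only: inner_add_left inner_S_zero)
    have "t \<in> {a + s / real d - r / real d .. a + s / real d + r / real d}
        \<longleftrightarrow> real d * (t - a) \<in> {s - r .. s + r}" for a s r :: real
    proof -
      have "a + s / real d - r / real d = a + (s - r) / real d" "a + s / real d + r / real d = a + (s + r) / real d"
        by (simp_all add: add_divide_distrib diff_divide_distrib)
      moreover have "y / real d \<le> t - a \<longleftrightarrow> y \<le> real d * (t - a)"
        "t - a \<le> y / real d \<longleftrightarrow> real d * (t - a) \<le> y" for y
        using d by (simp_all add: pos_divide_le_eq pos_le_divide_eq mult.commute)
      moreover have "a + y \<le> t \<longleftrightarrow> y \<le> t - a" "t \<le> a + y \<longleftrightarrow> t - a \<le> y" for y by auto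
      ultimately show ?thesis by (simp only: atLeastAtMost_iff)
    qed
    from this[of "offset d \<theta> (w 1) j" "c \<bullet> cis \<theta>" "1 / real d ^ n"]
    show ?thesis unfolding e by (simp add: mult.commute)
  qed
  then show ?thesis
    unfolding shadow_eq_intervals[OF d] centers_Suc_shift by fastforce
qed

lemma shadow_Suc:
  assumes d: "d > 0"
  shows "shadow d \<theta> w (Suc n) =
    (\<Union>j<d. (\<lambda>t. offset d \<theta> (w 1) j + t / real d) ` shadow d \<theta> (\<lambda>m. w (Suc m)) n)"
proof -
  have "real d * (t - a) \<in> B \<longleftrightarrow> t \<in> (\<lambda>t. a + t / real d) ` B" for t a B
    using d by (force simp: image_iff field_simps)
  then show ?thesis unfolding set_eq_iff mem_shadow_Suc[OF d] UN_iff by (simp only: simp_thms)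
qed

text \<open>Offsets are at most (d - 1)/d and half-widths at most 1/d in absolute value, which add
  up to 1. Hence two points of a shadow differ by at most 2, the bound later compared with
  \<open>reach d\<close>.\<close>

lemma shadow_subset:
  assumes d: "d > 0"
  shows "shadow d \<theta> w n \<subseteq> {-1..1}"
proof (induction n arbitrary: w)
  case 0
  then show ?case by (simp add: shadow_0)
next
  case (Suc n)
  have "offset d \<theta> (w 1) j + t / real d \<in> {-1..1}" if "t \<in> {-1..1}" for j t
  proof -
    have "\<bar>offset d \<theta> (w 1) j\<bar> \<le> (real d - 1) / real d * 1"
      unfolding offset_def abs_mult using d by (intro mult_mono) auto
    moreover have "\<bar>t / real d\<bar> \<le> 1 / real d"
      using that d by (simp add: divide_right_mono abs_le_iff)
    moreover have "(real d - 1) / real d * 1 + 1 / real d = 1" using d by (simp add: field_simps)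
    ultimately have "\<bar>offset d \<theta> (w 1) j + t / real d\<bar> \<le> 1" by linarith
    then show ?thesis by (simp add: abs_le_iff)
  qed
  then show ?case unfolding shadow_Suc[OF d] using Suc.IH by blast
qed

section \<open>Measurability of shadows and their lengths\<close>

lemma compact_shadow: "d > 0 \<Longrightarrow> compact (shadow d \<theta> w n)"
  unfolding shadow_eq_intervals by (intro compact_UN finite_centers) auto

lemma borel_shadow: "d > 0 \<Longrightarrow> shadow d \<theta> w n \<in> sets borel"
  by (intro borel_closed compact_imp_closed compact_shadow)

text \<open>Point, direction and angles may all vary with \<open>x\<close>. The point has to be a
  general function \<open>T\<close>, since the induction step replaces it by its rescaled version,
  which involves the first angle.\<close>

lemma pred_mem_shadow:
  assumes d: "d > 0"
    and "T \<in> borel_measurable M" "\<phi> \<in> borel_measurable M"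
    and "\<And>m. m \<ge> 1 \<Longrightarrow> w m \<in> borel_measurable M"
  shows "Measurable.pred M (\<lambda>x. T x \<in> shadow d (\<phi> x) (\<lambda>m. w m x) n)"
  using assms(2-)
proof (induction n arbitrary: T w)
  case 0
  then show ?case unfolding shadow_0 by measurable
next
  case (Suc n)
  note [measurable] = Suc.prems(1,2) Suc.prems(3)[OF order_refl]
  show ?case
    unfolding mem_shadow_Suc[OF d]
  proof (intro pred_intros_finite Suc.IH)
    show "(\<lambda>x. real d * (T x - offset d (\<phi> x) (w 1 x) j)) \<in> borel_measurable M" for j
      unfolding offset_def by measurable
  qed (use Suc.prems in simp_all)
qed

text \<open>Allows the angle sequence to be replaced by restricted families, which agree with it
  only on part of the index set.\<close>

lemma shadow_cong:
  assumes d: "d > 0" and "\<And>m. m \<ge> 1 \<Longrightarrow> w m = w' m"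
  shows "shadow d \<theta> w n = shadow d \<theta> w' n"
  using assms(2)
proof (induction n arbitrary: w w')
  case 0
  then show ?case by (simp add: shadow_0)
next
  case (Suc n)
  have "shadow d \<theta> (\<lambda>m. w (Suc m)) n = shadow d \<theta> (\<lambda>m. w' (Suc m)) n"
    using Suc.prems by (intro Suc.IH) simp
  then show ?case using Suc.prems[of 1] by (simp add: shadow_Suc[OF d])
qed

definition shadow_length :: "nat \<Rightarrow> real \<Rightarrow> (nat \<Rightarrow> real) \<Rightarrow> nat \<Rightarrow> real" where
  "shadow_length d \<theta> w n = measure lborel (shadow d \<theta> w n)"

lemma line_length_shadow:
  assumes "d > 0"
  shows "line_length \<theta> (Proj \<theta> ` D d w n) = shadow_length d \<theta> w n"
  using borel_shadow[OF assms, of \<theta> w n]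
  by (simp add: line_length_Proj shadow_length_def shadow_def measure_completion)

lemma shadow_length_bounds:
  assumes "d > 0"
  shows "0 \<le> shadow_length d \<theta> w n" "shadow_length d \<theta> w n \<le> 2"
proof -
  have "measure lborel (shadow d \<theta> w n) \<le> measure lborel {-1..1::real}"
    using shadow_subset[OF assms] borel_shadow[OF assms]
    by (intro measure_mono_fmeasurable) (auto simp: fmeasurable_def)
  then show "shadow_length d \<theta> w n \<le> 2" by (simp add: shadow_length_def)
qed (simp add: shadow_length_def)

text \<open>The length is the measure of a section of the jointly measurable set \<open>?Q\<close>,
  hence measurable as in Tonelli's theorem.\<close>

lemma borel_measurable_shadow_length:
  assumes d: "d > 0"
    and [measurable]: "\<phi> \<in> borel_measurable M"
    and w: "\<And>m. m \<ge> 1 \<Longrightarrow> w m \<in> borel_measurable M"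
  shows "(\<lambda>x. shadow_length d (\<phi> x) (\<lambda>m. w m x) n) \<in> borel_measurable M"
proof -
  let ?Q = "{p \<in> space (M \<Otimes>\<^sub>M lborel). snd p \<in> shadow d (\<phi> (fst p)) (\<lambda>m. w m (fst p)) n}"
  have "Measurable.pred (M \<Otimes>\<^sub>M lborel) (\<lambda>p. snd p \<in> shadow d (\<phi> (fst p)) (\<lambda>m. w m (fst p)) n)"
    using w by (intro pred_mem_shadow[OF d] measurable_compose[OF measurable_fst]) auto
  then have "?Q \<in> sets (M \<Otimes>\<^sub>M lborel)" by (simp add: pred_def)
  then have [measurable]: "(\<lambda>x. emeasure lborel (Pair x -` ?Q)) \<in> borel_measurable M"
    by (rule lborel.measurable_emeasure_Pair)
  have "(\<lambda>x. enn2real (emeasure lborel (Pair x -` ?Q))) \<in> borel_measurable M" by measurable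
  moreover have "enn2real (emeasure lborel (Pair x -` ?Q)) = shadow_length d (\<phi> x) (\<lambda>m. w m x) n"
    if "x \<in> space M" for x
  proof -
    have "Pair x -` ?Q = shadow d (\<phi> x) (\<lambda>m. w m x) n"
      using that by (auto simp: space_pair_measure)
    then show ?thesis by (simp add: shadow_length_def measure_def)
  qed
  ultimately show ?thesis by (subst (asm) measurable_cong)
qed

section \<open>Overlapping copies\<close>

text \<open>The autocorrelation of the indicator function of \<open>A\<close> at lag
  \<open>s\<close>.\<close>

definition overlap :: "real set \<Rightarrow> real \<Rightarrow> real" where
  "overlap A s = measure lborel {x\<in>A. x + s \<in> A}"

lemma emeasure_lborel_bounded_real:
  fixes A :: "real set"
  assumes "A \<subseteq> {a..b}"
  shows "emeasure lborel A < \<infinity>"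
proof -
  have "emeasure lborel A \<le> emeasure lborel {a..b}" using assms by (intro emeasure_mono) auto
  also have "\<dots> < \<infinity>" by (simp add: emeasure_lborel_Icc_eq)
  finally show ?thesis .
qed

lemma ennreal_overlap:
  fixes A :: "real set"
  assumes [measurable]: "A \<in> sets borel" and A: "A \<subseteq> {-1..1}"
  shows "ennreal (overlap A s) = (\<integral>\<^sup>+x. indicator A x * indicator A (x + s) \<partial>lborel)"
proof -
  have [measurable]: "{x\<in>A. x + s \<in> A} \<in> sets lborel"
  proof -
    have "{x\<in>A. x + s \<in> A} = {x \<in> space borel. x \<in> A \<and> x + s \<in> A}" by auto
    also have "\<dots> \<in> sets lborel" by measurable
    finally show ?thesis .
  qed
  have "emeasure lborel {x\<in>A. x + s \<in> A} < \<infinity>"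
    using A by (intro emeasure_lborel_bounded_real[of _ "-1" 1]) auto
  then have "ennreal (overlap A s) = emeasure lborel {x\<in>A. x + s \<in> A}"
    unfolding overlap_def by (intro emeasure_eq_ennreal_measure[symmetric]) simp
  also have "\<dots> = (\<integral>\<^sup>+x. indicator {x\<in>A. x + s \<in> A} x \<partial>lborel)" by simp
  also have "\<dots> = (\<integral>\<^sup>+x. indicator A x * indicator A (x + s) \<partial>lborel)"
    by (intro nn_integral_cong) (auto split: split_indicator)
  finally show ?thesis .
qed

lemma borel_measurable_overlap:
  assumes [measurable]: "A \<in> sets borel" and A: "A \<subseteq> {-1..1}"
  shows "overlap A \<in> borel_measurable borel"
proof -
  have "(\<lambda>s. enn2real (\<integral>\<^sup>+x. indicator A x * indicator A (x + s) \<partial>lborel)) \<in> borel_measurable borel"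
    by measurable
  moreover have "overlap A s = enn2real (\<integral>\<^sup>+x. indicator A x * indicator A (x + s) \<partial>lborel)" for s
    using ennreal_overlap[OF assms, of s] by (metis enn2real_ennreal measure_nonneg overlap_def)
  ultimately show ?thesis by (simp add: fun_eq_iff[symmetric] cong: measurable_cong)
qed

text \<open>By Tonelli and translation invariance, each \<open>x\<close> in \<open>A\<close>
  contributes the measure of \<open>A\<close>. Cutting off at R loses nothing because differences of
  points of \<open>A\<close> lie in [-2, 2].\<close>

lemma nn_integral_overlap:
  assumes [measurable]: "A \<in> sets borel" and A: "A \<subseteq> {-1..1}" and R: "R \<ge> 2"
  shows "(\<integral>\<^sup>+s. ennreal (overlap A s * indicator {-R..R} s) \<partial>lborel) = ennreal ((measure lborel A)\<^sup>2)"
proof -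
  have empty: "{x\<in>A. x + s \<in> A} = {}" if "s \<notin> {-R..R}" for s
  proof -
    { fix x assume "x \<in> A" "x + s \<in> A"
      then have "x \<in> {-1..1}" "x + s \<in> {-1..1}" using A by blast+
      then have "s \<in> {-R..R}" using R by auto
      with that have False by simp }
    then show ?thesis by blast
  qed
  have "overlap A s * indicator {-R..R} s = overlap A s" for s
  proof (cases "s \<in> {-R..R}")
    case False
    show ?thesis unfolding overlap_def empty[OF False] by simp
  qed simp
  then have "(\<integral>\<^sup>+s. ennreal (overlap A s * indicator {-R..R} s) \<partial>lborel)
      = (\<integral>\<^sup>+s. \<integral>\<^sup>+x. indicator A x * indicator A (x + s) \<partial>lborel \<partial>lborel)"
    by (simp only: ennreal_overlap[OF assms(1,2)])
  also have "\<dots> = (\<integral>\<^sup>+x. \<integral>\<^sup>+s. indicator A x * indicator A (x + s) \<partial>lborel \<partial>lborel)"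
    by (rule lborel_pair.Fubini'[symmetric]) measurable
  also have "\<dots> = (\<integral>\<^sup>+x. emeasure lborel A * indicator A x \<partial>lborel)"
  proof (intro nn_integral_cong)
    fix x :: real
    have "(\<integral>\<^sup>+s. indicator A x * indicator A (x + s) \<partial>lborel)
        = indicator A x * (\<integral>\<^sup>+s. indicator A (x + s) \<partial>lborel)"
      by (rule nn_integral_cmult) measurable
    also have "(\<integral>\<^sup>+s. indicator A (x + s) \<partial>lborel) = (\<integral>\<^sup>+s. indicator A s \<partial>lborel :: ennreal)"
      using nn_integral_real_affine[of "indicator A" 1 x] by simp
    finally show "(\<integral>\<^sup>+s. indicator A x * indicator A (x + s) \<partial>lborel) = emeasure lborel A * indicator A x"
      by (simp add: mult.commute)
  qed
  also have "\<dots> = emeasure lborel A * emeasure lborel A"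
    by (simp add: nn_integral_cmult)
  also have "emeasure lborel A = ennreal (measure lborel A)"
    using emeasure_lborel_bounded_real[OF A] by (intro emeasure_eq_ennreal_measure) simp
  finally show ?thesis by (simp add: ennreal_mult' power2_eq_square)
qed

section \<open>Unions of scaled copies of a set\<close>

lemma scaled_copy_vimage:
  assumes "d > 0"
  shows "(\<lambda>t. a + t / real d) ` A = (\<lambda>t. real d * (t - a)) -` A"
  using assms by (force simp: image_iff field_simps)

lemma borel_scaled_copy:
  assumes "d > 0" and [measurable]: "A \<in> sets borel"
  shows "(\<lambda>t. a + t / real d) ` A \<in> sets borel"
proof -
  have "(\<lambda>t. real d * (t - a)) -` A \<inter> space borel \<in> sets borel"
    by (rule measurable_sets) measurable
  then show ?thesis by (simp add: scaled_copy_vimage[OF assms(1)])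
qed

lemma measure_scaled_copy:
  assumes d: "d > 0" and A[measurable]: "A \<in> sets borel"
  shows "measure lborel ((\<lambda>t. a + t / real d) ` A) = measure lborel A / real d"
proof -
  let ?B = "(\<lambda>t. a + t / real d) ` A"
  have [measurable]: "?B \<in> sets borel" by (rule borel_scaled_copy[OF d A])
  have "emeasure lborel ?B = (\<integral>\<^sup>+t. indicator ?B t \<partial>lborel)" by simp
  also have "\<dots> = ennreal \<bar>1 / real d\<bar> * (\<integral>\<^sup>+t. indicator ?B (a + 1 / real d * t) \<partial>lborel)"
    using d by (intro nn_integral_real_affine) auto
  also have "(\<lambda>t. indicator ?B (a + 1 / real d * t)) = (indicator A :: real \<Rightarrow> ennreal)"
    using d by (auto simp: fun_eq_iff scaled_copy_vimage[OF d] split: split_indicator)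
  finally show ?thesis using d by (simp add: measure_def enn2real_mult)
qed

text \<open>Inclusion-exclusion is used for the pair \<open>i\<close>, \<open>k\<close> only; the
  other d - 2 copies enter through the union bound.\<close>

lemma measure_UN_scaled_copies_le:
  assumes d: "d > 0" and A[measurable]: "A \<in> sets borel" and A1: "A \<subseteq> {-1..1}"
    and ik: "i < d" "k < d" "i \<noteq> k"
  shows "measure lborel (\<Union>j<d. (\<lambda>t. a j + t / real d) ` A)
    \<le> measure lborel A - overlap A (real d * (a i - a k)) / real d"
proof -
  let ?B = "\<lambda>j. (\<lambda>t. a j + t / real d) ` A"
  let ?I = "{..<d} - {i, k}"
  let ?o = "{x\<in>A. x + real d * (a i - a k) \<in> A}"
  have Bb[measurable]: "?B j \<in> sets borel" for j by (rule borel_scaled_copy[OF d A])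
  have Bf: "?B j \<in> fmeasurable lborel" for j
  proof (rule fmeasurableI)
    have "?B j \<subseteq> {a j - 1 / real d .. a j + 1 / real d}"
    proof (intro image_subsetI)
      fix x assume "x \<in> A"
      then have "-1 \<le> x" "x \<le> 1" using A1 by auto
      then have "-1 / real d \<le> x / real d" "x / real d \<le> 1 / real d"
        using d by (intro divide_right_mono; simp)+
      then show "a j + x / real d \<in> {a j - 1 / real d .. a j + 1 / real d}" by simp
    qed
    then show "emeasure lborel (?B j) < \<infinity>" by (rule emeasure_lborel_bounded_real)
  qed simp
  have Bm: "measure lborel (?B j) = measure lborel A / real d" for j
    by (rule measure_scaled_copy[OF d A])
  \<comment> \<open>If a_i + x/d = a_k + y/d, then y = x + d (a_i - a_k): the common part is itself
    a scaled copy of an overlap set.\<close>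
  have o: "?B i \<inter> ?B k = (\<lambda>t. a i + t / real d) ` ?o"
    using d by (auto simp: scaled_copy_vimage[OF d] algebra_simps)
  have "?o = {x \<in> space borel. x \<in> A \<and> x + real d * (a i - a k) \<in> A}" by auto
  also have "\<dots> \<in> sets borel" by measurable
  finally have ob: "?o \<in> sets borel" .
  have "(\<Union>j<d. ?B j) = (?B i \<union> ?B k) \<union> (\<Union>j\<in>?I. ?B j)" using ik by auto
  then have "measure lborel (\<Union>j<d. ?B j)
      \<le> measure lborel (?B i \<union> ?B k) + measure lborel (\<Union>j\<in>?I. ?B j)"
    using measure_Un_le[of "?B i \<union> ?B k" lborel "\<Union>j\<in>?I. ?B j"] by simp
  also have "measure lborel (?B i \<union> ?B k)
      = measure lborel (?B i) + measure lborel (?B k) - measure lborel (?B i \<inter> ?B k)"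
    by (rule measure_Un3[OF Bf Bf])
  also have "measure lborel (?B i \<inter> ?B k) = overlap A (real d * (a i - a k)) / real d"
    unfolding o measure_scaled_copy[OF d ob] overlap_def ..
  also have "measure lborel (\<Union>j\<in>?I. ?B j) \<le> (\<Sum>j\<in>?I. measure lborel (?B j))"
    by (intro measure_UNION_le) auto
  also have "\<dots> = (real d - 2) * (measure lborel A / real d)"
  proof -
    have "card ?I = d - 2" using ik by (subst card_Diff_subset) auto
    moreover have "d \<ge> 2" using ik by linarith
    ultimately show ?thesis by (simp add: Bm of_nat_diff)
  qed
  finally show ?thesis using d unfolding Bm by (simp add: field_simps)
qed

section \<open>Averaging over the first rotation\<close>

text \<open>The reflection v = j l - u - \<beta> maps [0, l] onto the \<open>j\<close>-th of N
  adjacent tiles of length l. The two conditions place [a, b] inside the union of the tiles.\<close>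

lemma nn_integral_tile:
  fixes G :: "real \<Rightarrow> ennreal"
  assumes G[measurable]: "G \<in> borel_measurable borel" and l: "l > 0"
    and cover: "0 < a + \<beta>" "b + \<beta> \<le> l * (real N - 1)"
  shows "(\<integral>\<^sup>+v. G v * indicator {a..b} v \<partial>lborel)
    \<le> (\<Sum>j<N. \<integral>\<^sup>+u. G (real j * l - u - \<beta>) * indicator {0..l} u \<partial>lborel)"
proof -
  have tile: "(\<integral>\<^sup>+u. G (real j * l - u - \<beta>) * indicator {0..l} u \<partial>lborel)
      = (\<integral>\<^sup>+v. G v * indicator {real j * l - l - \<beta>..real j * l - \<beta>} v \<partial>lborel)" for j
  proof -
    have "(\<integral>\<^sup>+v. G v * indicator {real j * l - l - \<beta>..real j * l - \<beta>} v \<partial>lborel)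
      = (\<integral>\<^sup>+u. G (real j * l - \<beta> + -1 * u) *
           indicator {real j * l - l - \<beta>..real j * l - \<beta>} (real j * l - \<beta> + -1 * u) \<partial>lborel)"
      by (subst nn_integral_real_affine[where c = "-1" and t = "real j * l - \<beta>"]) auto
    also have "\<dots> = (\<integral>\<^sup>+u. G (real j * l - u - \<beta>) * indicator {0..l} u \<partial>lborel)"
      by (intro nn_integral_cong) (auto split: split_indicator simp: algebra_simps)
    finally show ?thesis ..
  qed
  have "(\<integral>\<^sup>+v. G v * indicator {a..b} v \<partial>lborel)
      \<le> (\<integral>\<^sup>+v. (\<Sum>j<N. G v * indicator {real j * l - l - \<beta>..real j * l - \<beta>} v) \<partial>lborel)"
  proof (intro nn_integral_mono)
    fix v
    let ?f = "\<lambda>j. G v * indicator {real j * l - l - \<beta>..real j * l - \<beta>} v"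
    show "G v * indicator {a..b} v \<le> (\<Sum>j<N. ?f j)"
    proof (cases "v \<in> {a..b}")
      case True
      \<comment> \<open>Index of the tile containing \<open>v\<close>. Positivity of the quotient
        keeps \<open>nat\<close> from truncating, and the bound on \<open>b\<close> gives
        \<open>j < N\<close>.\<close>
      define j where "j = nat \<lceil>(v + \<beta>) / l\<rceil>"
      have pos: "0 < (v + \<beta>) / l" using True cover(1) l by (intro divide_pos_pos) auto
      then have "\<lceil>(v + \<beta>) / l\<rceil> > 0" by simp
      then have rj: "real j = of_int \<lceil>(v + \<beta>) / l\<rceil>" unfolding j_def by simp
      then have "(v + \<beta>) / l \<le> real j" "real j < (v + \<beta>) / l + 1" by linarith+
      then have j: "v + \<beta> \<le> real j * l" "real j * l < v + \<beta> + l"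
        using l by (simp_all add: field_simps)
      have "real j * l < l * real N" using j(2) True cover(2) by (simp add: algebra_simps)
      then have "j < N" using l by (simp add: mult.commute)
      have "G v * indicator {a..b} v = ?f j" using True j by (auto split: split_indicator)
      also have "\<dots> \<le> (\<Sum>j<N. ?f j)" by (rule member_le_sum) (use \<open>j < N\<close> in auto)
      finally show ?thesis .
    qed auto
  qed
  also have "\<dots> = (\<Sum>j<N. \<integral>\<^sup>+v. G v * indicator {real j * l - l - \<beta>..real j * l - \<beta>} v \<partial>lborel)"
    by (rule nn_integral_sum) measurable
  finally show ?thesis by (simp add: tile)
qed

text \<open>Substitute s = R sin v and bound the Jacobian R cos v by R. The branch around 2 pi,
  rather than around 0, secures \<open>0 < a + \<beta>\<close> in \<open>nn_integral_tile\<close>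
  for every \<theta> in [0, pi].\<close>

lemma nn_integral_overlap_sin:
  assumes A: "A \<in> sets borel" "A \<subseteq> {-1..1}" and R: "R \<ge> 2"
  shows "ennreal ((measure lborel A)\<^sup>2)
    \<le> ennreal R * (\<integral>\<^sup>+v. ennreal (overlap A (R * sin v)) * indicator {3/2*pi..5/2*pi} v \<partial>lborel)"
proof -
  note [measurable] = borel_measurable_overlap[OF A]
  have s: "sin (3/2*pi) = -1" "sin (5/2*pi) = 1"
    using sin_periodic[of "pi/2"] by - (rule sin_3over2_pi, simp)
  have c: "0 \<le> cos v" if "v \<in> {3/2*pi..5/2*pi}" for v
    using cos_ge_zero[of "v - 2*pi"] cos_periodic[of "v - 2*pi"] that by simp
  have "(\<integral>\<^sup>+x. ennreal (overlap A x * indicator {R * sin (3/2*pi)..R * sin (5/2*pi)} x) \<partial>lborel)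
    = (\<integral>\<^sup>+v. ennreal (overlap A (R * sin v) * (R * cos v) * indicator {3/2*pi..5/2*pi} v) \<partial>lborel)"
    using R c by (intro nn_integral_substitution)
      (auto simp: set_borel_measurable_def intro!: derivative_eq_intros continuous_intros)
  also have "\<dots> \<le> (\<integral>\<^sup>+v. ennreal R * (ennreal (overlap A (R * sin v)) * indicator {3/2*pi..5/2*pi} v) \<partial>lborel)"
  proof (intro nn_integral_mono)
    fix v :: real
    have "overlap A (R * sin v) * (R * cos v) \<le> overlap A (R * sin v) * (R * 1)"
      using R by (intro mult_left_mono) (auto simp: overlap_def)
    also have "ennreal (overlap A (R * sin v) * (R * 1)) = ennreal R * ennreal (overlap A (R * sin v))"
      using R by (simp add: ennreal_mult' overlap_def mult.commute)
    finally show "ennreal (overlap A (R * sin v) * (R * cos v) * indicator {3/2*pi..5/2*pi} v)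
      \<le> ennreal R * (ennreal (overlap A (R * sin v)) * indicator {3/2*pi..5/2*pi} v)"
      by (auto split: split_indicator simp: ennreal_leI)
  qed
  also have "\<dots> = ennreal R * (\<integral>\<^sup>+v. ennreal (overlap A (R * sin v)) * indicator {3/2*pi..5/2*pi} v \<partial>lborel)"
    by (rule nn_integral_cmult) measurable
  finally show ?thesis using nn_integral_overlap[OF A R] by (simp only: s mult_1_right mult_minus1_right)
qed

section \<open>Displacement of neighbouring copies\<close>

text \<open>Makes the index cyclic, so that the last copy is a neighbour of the first and
  \<open>j\<close> can run through two full turns.\<close>

lemma offset_mod:
  assumes "d > 0"
  shows "offset d \<theta> u (j mod d) = offset d \<theta> u j"
proof -
  have "real j = real d * real (j div d) + real (j mod d)"
    by (metis mult_div_mod_eq of_nat_add of_nat_mult)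
  then have "2 * pi / real d * real j = 2 * pi / real d * real (j mod d) + 2 * real (j div d) * pi"
    using assms by (simp add: field_simps)
  then have "2 * pi / real d * real j - u - \<theta>
      = (2 * pi / real d * real (j mod d) - u - \<theta>) + 2 * real (j div d) * pi" by simp
  then have "cos (2 * pi / real d * real j - u - \<theta>) = cos (2 * pi / real d * real (j mod d) - u - \<theta>)"
    using cos_add[of "2 * pi / real d * real (j mod d) - u - \<theta>" "2 * real (j div d) * pi"]
    by (simp only: cos_2npi sin_2npi mult_1_right mult_zero_right diff_zero)
  then show ?thesis by (simp only: offset_def)
qed

text \<open>The identity cos p - cos (p + 2h) = 2 sin (p + h) sin h with h = pi/d. The midpoint
  shift h is absorbed into the phase to match the tiles of \<open>nn_integral_tile\<close>.\<close>

lemma offset_diff: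
  assumes "d > 0"
  shows "real d * (offset d \<theta> u j - offset d \<theta> u (Suc j))
    = 2 * (real d - 1) * sin (pi / real d) * sin (real j * (2 * pi / real d) - u - (\<theta> - pi / real d))"
proof -
  define p where "p = 2 * pi / real d * real j - u - \<theta>"
  have q: "2 * pi / real d * real (Suc j) - u - \<theta> = p + 2 * (pi / real d)"
    by (simp add: p_def algebra_simps add_divide_distrib)
  have r: "real j * (2 * pi / real d) - u - (\<theta> - pi / real d) = p + pi / real d"
    by (simp add: p_def algebra_simps)
  have "cos p - cos (p + 2 * (pi / real d)) = 2 * sin (p + pi / real d) * sin (pi / real d)"
    unfolding cos_diff_cos by (simp add: add_divide_distrib)
  then have "(real d - 1) * cos p - (real d - 1) * cos (p + 2 * (pi / real d))
      = 2 * (real d - 1) * sin (pi / real d) * sin (p + pi / real d)"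
    by (simp add: right_diff_distrib[symmetric] algebra_simps)
  moreover have "real d * (offset d \<theta> u j - offset d \<theta> u (Suc j))
      = (real d - 1) * cos p - (real d - 1) * cos (p + 2 * (pi / real d))"
    unfolding offset_def q p_def[symmetric] using assms by (simp add: right_diff_distrib)
  ultimately show ?thesis unfolding r by simp
qed

text \<open>By the chord formula, \<open>reach d / d\<close> is the distance between the centres of adjacent disks of the first generation.\<close>
definition reach :: "nat \<Rightarrow> real" where
  "reach d = 2 * (real d - 1) * sin (pi / real d)"

text \<open>For x = pi/d \<le> pi/3 the mean value theorem gives sin x \<ge> x/2, hence sin x \<ge>
  3/(2d) by pi > 3, and 3 (d - 1)/d \<ge> 2. Thus R sin v sweeps all possible differences of shadow
  points.\<close>

lemma reach_ge_2:
  assumes "d \<ge> 3"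
  shows "reach d \<ge> 2"
proof -
  have d: "real d \<ge> 3" using assms by simp
  let ?x = "pi / real d"
  have x: "0 < ?x" using d by simp
  have x3: "?x \<le> pi / 3" using d by (intro divide_left_mono) auto
  obtain z where z: "0 < z" "z < ?x" "sin ?x - sin 0 = (?x - 0) * cos z"
    using MVT2[of 0 ?x sin cos] x by (auto intro!: derivative_eq_intros)
  have "cos (pi / 3) \<le> cos z" using z x3 pi_gt_zero by (intro cos_monotone_0_pi_le) linarith+
  then have "?x * (1 / 2) \<le> ?x * cos z" using x unfolding cos_60 by (intro mult_left_mono) auto
  also have "\<dots> = sin ?x" using z(3) by simp
  finally have "?x * (1 / 2) \<le> sin ?x" .
  moreover have "3 / real d \<le> ?x" using d pi_gt3 by (intro divide_right_mono) auto
  ultimately have s: "3 / (2 * real d) \<le> sin ?x" by (simp add: field_simps)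
  have "2 \<le> 2 * (real d - 1) * (3 / (2 * real d))" using d by (simp add: field_simps)
  also have "\<dots> \<le> reach d" unfolding reach_def
    using d s by (intro mult_left_mono) auto
  finally show ?thesis .
qed

text \<open>Product of 1/d (scale of a copy), 1/(2d) (averaging over 2d neighbour pairs), d/(2 pi)
  (density of the angle) and 1/R (Jacobian).\<close>

definition gain :: "nat \<Rightarrow> real" where
  "gain d = 1 / (4 * pi * real d * reach d)"

lemma gain_pos: "d \<ge> 3 \<Longrightarrow> gain d > 0"
  using reach_ge_2[of d] by (simp add: gain_def)

text \<open>Keeps x - \<open>gain d\<close> x^2 nonnegative for lengths x in [0, 2].\<close>

lemma gain_le_half:
  assumes "d \<ge> 3"
  shows "gain d \<le> 1 / 2"
proof -
  have "1 * 1 * 2 \<le> pi * real d * reach d"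
    using assms pi_gt3 reach_ge_2[OF assms] by (intro mult_mono) auto
  then show ?thesis unfolding gain_def by (intro divide_left_mono) auto
qed

text \<open>For each rotation every neighbour pair yields an upper bound for the union. Averaging
  over the pairs as well as the rotation makes the displacement phase sweep a full monotone branch
  of sine.\<close>

lemma average_UN_scaled_copies_le:
  assumes d: "d \<ge> 3" and A: "A \<in> sets borel" "A \<subseteq> {-1..1}" and \<theta>: "\<theta> \<in> {0..pi}"
    and meas: "(\<lambda>u. measure lborel (\<Union>j<d. (\<lambda>t. offset d \<theta> u j + t / real d) ` A)) \<in> borel_measurable borel"
  shows "(\<integral>\<^sup>+u. ennreal (measure lborel (\<Union>j<d. (\<lambda>t. offset d \<theta> u j + t / real d) ` A))
      \<partial>uniform_measure lborel {0..2 * pi / real d})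
    \<le> ennreal (measure lborel A - gain d * (measure lborel A)\<^sup>2)"
proof -
  have d0: "d > 0" using d by auto
  define l where "l = 2 * pi / real d"
  define \<beta> where "\<beta> = \<theta> - pi / real d"
  define R where "R = reach d"
  define a where "a = measure lborel A"
  define m where "m u = measure lborel (\<Union>j<d. (\<lambda>t. offset d \<theta> u j + t / real d) ` A)" for u
  define G where "G v = ennreal (overlap A (R * sin v))" for v
  define X where "X = (\<integral>\<^sup>+u. ennreal (m u) * indicator {0..l} u \<partial>lborel)"
  \<comment> \<open>\<open>2 * d\<close> tiles of length \<open>2 * pi / d\<close> cover the fixed interval \<open>{3/2*pi..5/2*pi}\<close> for every \<open>\<theta>\<close>;
    on it \<open>sin\<close> increases from -1 to 1, so that \<open>s = R * sin v\<close> can be substituted.\<close>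
  define Y where "Y = (\<Sum>j<2*d. \<integral>\<^sup>+u. G (real j * l - u - \<beta>) * indicator {0..l} u \<partial>lborel)"
  have l: "l > 0" using d0 by (simp add: l_def)
  have R: "R \<ge> 2" unfolding R_def by (rule reach_ge_2[OF d])
  note [measurable] = borel_measurable_overlap[OF A] meas[folded m_def]
  have G[measurable]: "G \<in> borel_measurable borel" unfolding G_def by measurable
  have a0: "a \<ge> 0" by (simp add: a_def)
  have m0: "m u \<ge> 0" for u by (simp add: m_def)

  \<comment> \<open>Written as a sum, since subtraction in \<open>ennreal\<close> truncates.\<close>
  have pointwise: "ennreal (m u) + ennreal (1 / real d) * G (real j * l - u - \<beta>) \<le> ennreal a" for u j
  proof -
    have "j mod d \<noteq> Suc j mod d"
      using d by (simp add: mod_Suc)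
    then have "m u \<le> a - overlap A (real d * (offset d \<theta> u (j mod d) - offset d \<theta> u (Suc j mod d))) / real d"
      unfolding m_def a_def using d0 by (intro measure_UN_scaled_copies_le A) auto
    also have "real d * (offset d \<theta> u (j mod d) - offset d \<theta> u (Suc j mod d)) = R * sin (real j * l - u - \<beta>)"
      unfolding offset_mod[OF d0] offset_diff[OF d0] R_def reach_def l_def \<beta>_def ..
    finally have "m u + 1 / real d * overlap A (R * sin (real j * l - u - \<beta>)) \<le> a" by simp
    then show ?thesis
      unfolding G_def using m0 d0
      by (simp add: ennreal_mult'[symmetric] ennreal_plus[symmetric] overlap_def ennreal_leI del: ennreal_plus)
  qed

  have "ennreal (a\<^sup>2) \<le> ennreal R * (\<integral>\<^sup>+v. G v * indicator {3/2*pi..5/2*pi} v \<partial>lborel)"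
    unfolding a_def G_def by (rule nn_integral_overlap_sin[OF A R])
  also have "\<dots> \<le> ennreal R * Y"
    unfolding Y_def
  proof (intro mult_left_mono nn_integral_tile G l)
    \<comment> \<open>The left condition is tightest at \<theta> = 0, the right one at \<theta> =
      pi; both follow from pi/d \<le> pi/3.\<close>
    have "pi / real d \<le> pi / 3" using d by (intro divide_left_mono) auto
    then show "0 < 3/2*pi + \<beta>" using \<theta> pi_gt_zero unfolding \<beta>_def atLeastAtMost_iff by linarith
    have "l * (real (2*d) - 1) = 4 * pi - 2 * (pi / real d)"
      unfolding l_def using d0 by (simp add: field_simps)
    then show "5/2*pi + \<beta> \<le> l * (real (2*d) - 1)"
      using \<theta> \<open>pi / real d \<le> pi / 3\<close> pi_gt_zero unfolding \<beta>_def atLeastAtMost_iff by linarith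
  qed simp
  finally have Y: "ennreal (a\<^sup>2) \<le> ennreal R * Y" .

  \<comment> \<open>Integrate the pointwise bound over one period and add it up over the 2d pairs;
    the overlap terms sum to \<open>Y\<close>.\<close>
  have "ennreal (2 * real d) * X + ennreal (1 / real d) * Y
      = (\<Sum>j<2*d. X + ennreal (1 / real d) * (\<integral>\<^sup>+u. G (real j * l - u - \<beta>) * indicator {0..l} u \<partial>lborel))"
    unfolding Y_def by (simp add: sum.distrib sum_distrib_left ennreal_mult ennreal_of_nat_eq_real_of_nat)
  also have "\<dots> = (\<Sum>j<2*d. \<integral>\<^sup>+u. (ennreal (m u) + ennreal (1 / real d) * G (real j * l - u - \<beta>)) * indicator {0..l} u \<partial>lborel)"
    unfolding X_def
    by (subst nn_integral_cmult[symmetric], measurable, subst nn_integral_add[symmetric], measurable)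
       (simp add: distrib_right mult.assoc)
  also have "\<dots> \<le> (\<Sum>j<2*d. \<integral>\<^sup>+u. ennreal a * indicator {0..l} u \<partial>lborel)"
    by (intro sum_mono nn_integral_mono mult_right_mono pointwise) simp
  also have "\<dots> = ennreal (2 * real d) * ennreal (a * l)"
    using l a0 by (simp add: nn_integral_cmult ennreal_mult ennreal_of_nat_eq_real_of_nat)
  finally have main: "ennreal (2 * real d) * X + ennreal (1 / real d) * Y \<le> ennreal (2 * real d) * ennreal (a * l)" .

  \<comment> \<open>Finiteness permits passing to real numbers, where the terms can be
    rearranged.\<close>
  have "ennreal (2 * real d) * X + ennreal (1 / real d) * Y < \<infinity>"
    using main by (rule le_less_trans) (simp add: ennreal_mult[symmetric] a0 l less_imp_le ennreal_mult_less_top)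
  then have fin: "X < \<infinity>" "Y < \<infinity>"
    using d0 by (auto simp: ennreal_mult_less_top ennreal_add_less_top less_top[symmetric] ennreal_mult_eq_top_iff)
  obtain x where x: "X = ennreal x" "x \<ge> 0" using fin(1) by (cases X) auto
  obtain y where y: "Y = ennreal y" "y \<ge> 0" using fin(2) by (cases Y) auto
  have main': "2 * real d * x + 1 / real d * y \<le> 2 * real d * (a * l)"
    using main x y d0 a0 l by (simp add: ennreal_mult'[symmetric] ennreal_plus[symmetric] del: ennreal_plus)
  have Y': "a\<^sup>2 \<le> R * y"
    using Y y R by (simp add: ennreal_mult'[symmetric])
  have "x / l \<le> a - gain d * a\<^sup>2"
  proof -
    have "gain d * a\<^sup>2 \<le> gain d * (R * y)"
      using Y' gain_pos[OF d] by (intro mult_left_mono) auto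
    also have "\<dots> = (1 / real d * y) / (2 * real d * l)"
      unfolding gain_def R_def[symmetric] l_def using R d0 by (simp add: field_simps)
    also have "\<dots> \<le> (2 * real d * (a * l) - 2 * real d * x) / (2 * real d * l)"
      using main' l d0 by (intro divide_right_mono) auto
    also have "\<dots> = a - x / l" using l d0 by (simp add: field_simps)
    finally show ?thesis by simp
  qed
  moreover have "(\<integral>\<^sup>+u. ennreal (m u) \<partial>uniform_measure lborel {0..l}) = X / ennreal l"
    unfolding X_def using l by (subst nn_integral_uniform_measure) auto
  then have "(\<integral>\<^sup>+u. ennreal (m u) \<partial>uniform_measure lborel {0..l}) = ennreal (x / l)"
    using x l by (simp add: divide_ennreal)
  ultimately show ?thesis unfolding m_def l_def a_def by (simp add: ennreal_leI)
qed

section \<open>The recursion for the expected shadow length\<close>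

text \<open>If x exceeds C/(n + 1), then c x^2 is at least c C^2/(n + 1)^2 \<ge> 2C/(n + 1)^2. This
  covers the gap C/n - C/(n + 1) = C/(n (n + 1)), because n + 1 \<le> 2n.\<close>

lemma quadratic_decay_step:
  fixes x c C :: real
  assumes c: "c > 0" and C: "C \<ge> 2 / c" and n: "n \<ge> 1" and x: "0 \<le> x" "x \<le> C / real n"
  shows "x - c * x\<^sup>2 \<le> C / real (Suc n)"
proof (cases "x \<le> C / real (Suc n)")
  case True
  moreover have "c * x\<^sup>2 \<ge> 0" using c by simp
  ultimately show ?thesis by linarith
next
  case False
  have C0: "C > 0" using c C by (metis divide_pos_pos less_le_trans zero_less_numeral)
  have cC: "c * C \<ge> 2" using C c by (simp add: field_simps)
  have "2 * C * (1 / real (Suc n))\<^sup>2 \<le> c * C * C * (1 / real (Suc n))\<^sup>2"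
    using cC C0 by (intro mult_right_mono) auto
  also have "\<dots> = c * (C / real (Suc n))\<^sup>2" by (simp add: power2_eq_square)
  also have "\<dots> \<le> c * x\<^sup>2"
    using False C0 c by (intro mult_left_mono power_mono) auto
  finally have "x - c * x\<^sup>2 \<le> C / real n - 2 * C * (1 / real (Suc n))\<^sup>2" using x(2) by linarith
  also have "\<dots> \<le> C / real (Suc n)"
  proof -
    have "1 / real n - 1 / real (Suc n) = 1 / (real n * real (Suc n))"
      using n by (simp add: field_simps)
    also have "\<dots> \<le> 2 * (1 / real (Suc n))\<^sup>2"
    proof -
      have "real (Suc n) * real (Suc n) \<le> 2 * (real n * real (Suc n))"
        using n by (simp add: mult.assoc[symmetric])
      then have "1 / (real n * real (Suc n)) \<le> 2 / (real (Suc n) * real (Suc n))"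
        using n by (simp add: divide_simps)
      then show ?thesis by (simp add: power2_eq_square)
    qed
    finally have "C * (1 / real n - 1 / real (Suc n)) \<le> C * (2 * (1 / real (Suc n))\<^sup>2)"
      using C0 by (intro mult_left_mono) auto
    then show ?thesis by (simp add: algebra_simps)
  qed
  finally show ?thesis .
qed

text \<open>Nonnegativity of the variance, that is, Jensen's inequality for the square.\<close>

lemma (in prob_space) integral_minus_square_le:
  fixes f :: "'a \<Rightarrow> real"
  assumes c: "c \<ge> 0" and f: "integrable M f" "integrable M (\<lambda>x. (f x)\<^sup>2)"
  shows "(\<integral>x. f x - c * (f x)\<^sup>2 \<partial>M) \<le> expectation f - c * (expectation f)\<^sup>2"
proof -
  have "0 \<le> variance f" by simp
  then have "(expectation f)\<^sup>2 \<le> expectation (\<lambda>x. (f x)\<^sup>2)" using f by (simp add: variance_eq)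
  then have "c * (expectation f)\<^sup>2 \<le> c * expectation (\<lambda>x. (f x)\<^sup>2)" using c by (rule mult_left_mono)
  then show ?thesis using f by simp
qed

section \<open>Independent, uniformly distributed angles\<close>

locale random_angles = prob_space M for M :: "'a measure" +
  fixes d :: nat and \<omega> :: "nat \<Rightarrow> 'a \<Rightarrow> real"
  assumes d: "d \<ge> 3"
    and indep: "indep_vars (\<lambda>_. borel) \<omega> {1..}"
    and distr_angle: "\<And>m. m \<ge> 1 \<Longrightarrow> distr M borel (\<omega> m) = uniform_measure lborel {0..2 * pi / real d}"
begin

lemma d_pos: "d > 0"
  using d by simp

lemma measurable_angle: "m \<ge> 1 \<Longrightarrow> \<omega> m \<in> borel_measurable M"
  using indep unfolding indep_vars_def by auto

lemma borel_measurable_length: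
  "(\<lambda>x. shadow_length d \<theta> (\<lambda>m. \<omega> (k + m) x) n) \<in> borel_measurable M"
  by (intro borel_measurable_shadow_length d_pos measurable_angle) auto

lemma integrable_length:
  "integrable M (\<lambda>x. shadow_length d \<theta> (\<lambda>m. \<omega> (k + m) x) n)"
  "integrable M (\<lambda>x. (shadow_length d \<theta> (\<lambda>m. \<omega> (k + m) x) n)\<^sup>2)"
proof -
  note [measurable] = borel_measurable_length
  show "integrable M (\<lambda>x. shadow_length d \<theta> (\<lambda>m. \<omega> (k + m) x) n)"
    using shadow_length_bounds[OF d_pos] by (intro integrable_const_bound[where B=2]) auto
  have "\<bar>(shadow_length d \<theta> (\<lambda>m. \<omega> (k + m) x) n)\<^sup>2\<bar> \<le> 2\<^sup>2" for x
    using shadow_length_bounds[OF d_pos] by (simp only: abs_power2) (intro power_mono; simp)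
  then show "integrable M (\<lambda>x. (shadow_length d \<theta> (\<lambda>m. \<omega> (k + m) x) n)\<^sup>2)"
    by (intro integrable_const_bound[where B="2\<^sup>2"]) auto
qed

text \<open>Integrate over the angle \<open>\<omega> (Suc k)\<close> first, with the later angles
  frozen, using \<open>average_UN_scaled_copies_le\<close>. Peeling off this angle advances the
  shift from \<open>k\<close> to \<open>Suc k\<close>.\<close>

lemma expectation_length_Suc_le:
  assumes \<theta>: "\<theta> \<in> {0..pi}"
  shows "(\<integral>x. shadow_length d \<theta> (\<lambda>m. \<omega> (k + m) x) (Suc n) \<partial>M)
    \<le> (\<integral>x. shadow_length d \<theta> (\<lambda>m. \<omega> (Suc k + m) x) n
          - gain d * (shadow_length d \<theta> (\<lambda>m. \<omega> (Suc k + m) x) n)\<^sup>2 \<partial>M)"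
proof -
  define I where "I = {Suc (Suc k)..}"
  define H :: "(nat \<Rightarrow> real) measure" where "H = PiM {Suc k} (\<lambda>_. borel)"
  define P :: "(nat \<Rightarrow> real) measure" where "P = PiM I (\<lambda>_. borel)"
  \<comment> \<open>A one-element family rather than a single variable, so that independence of
    families over disjoint index sets applies.\<close>
  define head where "head x = restrict (\<lambda>m. \<omega> m x) {Suc k}" for x
  define tail where "tail x = restrict (\<lambda>m. \<omega> m x) I" for x
  define U where "U = uniform_measure lborel {0..2 * pi / real d}"
  \<comment> \<open>At \<open>m = 0\<close> this reads \<open>v k\<close>, outside \<open>I\<close>;
    \<open>shadow_cong\<close> compares indices from 1 on.\<close>
  define F where "F u v = shadow_length d \<theta> (\<lambda>m. if m = 1 then u else v (k + m)) (Suc n)"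
    for u and v :: "nat \<Rightarrow> real"
  define L where "L v = shadow_length d \<theta> (\<lambda>m. v (Suc k + m)) n" for v :: "nat \<Rightarrow> real"

  have U: "distr M borel (\<omega> (Suc k)) = U" unfolding U_def by (rule distr_angle) simp
  have [measurable]: "\<omega> (Suc k) \<in> borel_measurable M" by (rule measurable_angle) simp
  have [measurable]: "head \<in> measurable M H"
    unfolding head_def H_def using measurable_angle by (intro measurable_restrict) auto
  have [measurable]: "tail \<in> measurable M P"
    unfolding tail_def P_def using measurable_angle by (intro measurable_restrict) (auto simp: I_def)
  interpret U: prob_space U unfolding U[symmetric] by (rule prob_space_distr) simp
  interpret H: prob_space "distr M H head" by (rule prob_space_distr) simp
  interpret N: prob_space "distr M P tail" by (rule prob_space_distr) simp
  interpret HN: pair_sigma_finite "distr M H head" "distr M P tail" ..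

  have component: "(\<lambda>v. v m) \<in> borel_measurable P" if "m \<in> I" for m
    unfolding P_def using that by (rule measurable_component_singleton)
  have [measurable]: "(\<lambda>h. h (Suc k)) \<in> borel_measurable H"
    unfolding H_def by (rule measurable_component_singleton) simp
  have F[measurable]: "(\<lambda>p. F (fst p) (snd p)) \<in> borel_measurable (borel \<Otimes>\<^sub>M P)"
    unfolding F_def
  proof (intro borel_measurable_shadow_length d_pos)
    fix m :: nat assume "m \<ge> 1"
    then show "(\<lambda>p. if m = 1 then fst p else snd p (k + m)) \<in> borel_measurable (borel \<Otimes>\<^sub>M P)"
      using measurable_compose[OF measurable_snd component, of "k + m"] by (cases "m = 1") (auto simp: I_def)
  qed simp
  have F1[measurable]: "(\<lambda>u. F u v) \<in> borel_measurable borel" for v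
    unfolding F_def
  proof (intro borel_measurable_shadow_length d_pos)
    show "(\<lambda>u. if m = 1 then u else v (k + m)) \<in> borel_measurable borel" for m
      by (cases "m = 1") auto
  qed simp
  have L[measurable]: "L \<in> borel_measurable P"
    unfolding L_def by (intro borel_measurable_shadow_length d_pos component) (auto simp: I_def)
  have FH: "(\<lambda>p. F (fst p (Suc k)) (snd p)) \<in> borel_measurable (H \<Otimes>\<^sub>M P)"
    using measurable_compose[OF _ F, of "\<lambda>p. (fst p (Suc k), snd p)" "H \<Otimes>\<^sub>M P"] by simp

  have "indep_var H head P tail"
    unfolding P_def tail_def H_def head_def by (rule indep_var_restrict[OF indep]) (auto simp: I_def)
  then have joint: "distr M (H \<Otimes>\<^sub>M P) (\<lambda>x. (head x, tail x)) = distr M H head \<Otimes>\<^sub>M distr M P tail"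
    unfolding indep_var_distribution_eq by simp

  have F_eq: "shadow_length d \<theta> (\<lambda>m. \<omega> (k + m) x) (Suc n) = F (head x (Suc k)) (tail x)" for x
    unfolding F_def shadow_length_def
    by (intro arg_cong[where f = "measure lborel"] shadow_cong d_pos) (auto simp: head_def tail_def I_def)
  have L_eq: "shadow_length d \<theta> (\<lambda>m. \<omega> (Suc k + m) x) n = L (tail x)" for x
    unfolding L_def shadow_length_def
    by (intro arg_cong[where f = "measure lborel"] shadow_cong d_pos) (auto simp: tail_def I_def)

  have inner: "(\<integral>\<^sup>+u. ennreal (F u v) \<partial>U) \<le> ennreal (L v - gain d * (L v)\<^sup>2)" for v
  proof -
    let ?A = "shadow d \<theta> (\<lambda>m. v (Suc k + m)) n"
    have "shadow d \<theta> (\<lambda>m. if Suc m = 1 then u else v (k + Suc m)) n = ?A" for u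
      by (intro shadow_cong d_pos) auto
    then have F_UN: "F u v = measure lborel (\<Union>j<d. (\<lambda>t. offset d \<theta> u j + t / real d) ` ?A)" for u
      unfolding F_def shadow_length_def shadow_Suc[OF d_pos] by (simp only: refl if_True)
    show ?thesis
      using F1[of v] unfolding F_UN U_def L_def shadow_length_def
      by (intro average_UN_scaled_copies_le d borel_shadow d_pos shadow_subset \<theta>)
  qed

  \<comment> \<open>Needed so that \<open>ennreal\<close> does not cut the difference off at
    0.\<close>
  have nonneg: "0 \<le> L v - gain d * (L v)\<^sup>2" for v
  proof -
    have b: "0 \<le> L v" "L v \<le> 2" unfolding L_def by (rule shadow_length_bounds[OF d_pos])+
    have "gain d * L v \<le> 1 / 2 * 2"
      using b gain_le_half[OF d] gain_pos[OF d] by (intro mult_mono) auto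
    then have "gain d * L v * L v \<le> 1 * L v" using b by (intro mult_right_mono) auto
    then show ?thesis by (simp add: power2_eq_square mult.assoc)
  qed

  have "(\<integral>\<^sup>+x. ennreal (shadow_length d \<theta> (\<lambda>m. \<omega> (k + m) x) (Suc n)) \<partial>M)
      = (\<integral>\<^sup>+p. ennreal (F (fst p (Suc k)) (snd p)) \<partial>distr M (H \<Otimes>\<^sub>M P) (\<lambda>x. (head x, tail x)))"
    unfolding F_eq using FH by (subst nn_integral_distr) auto
  \<comment> \<open>Independence makes the joint law a product; Tonelli then puts the head integral
    inside.\<close>
  also have "\<dots> = (\<integral>\<^sup>+v. \<integral>\<^sup>+h. ennreal (F (h (Suc k)) v) \<partial>distr M H head \<partial>distr M P tail)"
    unfolding joint using FH by (subst HN.nn_integral_snd[symmetric]) (auto simp: split_beta')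
  also have "\<dots> = (\<integral>\<^sup>+v. \<integral>\<^sup>+u. ennreal (F u v) \<partial>U \<partial>distr M P tail)"
  proof (intro nn_integral_cong)
    fix v
    have "(\<integral>\<^sup>+h. ennreal (F (h (Suc k)) v) \<partial>distr M H head) = (\<integral>\<^sup>+x. ennreal (F (head x (Suc k)) v) \<partial>M)"
      using measurable_compose[OF _ F1, of "\<lambda>h. h (Suc k)" H v] by (intro nn_integral_distr) auto
    also have "\<dots> = (\<integral>\<^sup>+u. ennreal (F u v) \<partial>U)"
      unfolding U[symmetric] by (subst nn_integral_distr) (auto simp: head_def)
    finally show "(\<integral>\<^sup>+h. ennreal (F (h (Suc k)) v) \<partial>distr M H head) = (\<integral>\<^sup>+u. ennreal (F u v) \<partial>U)" .
  qed
  also have "\<dots> \<le> (\<integral>\<^sup>+v. ennreal (L v - gain d * (L v)\<^sup>2) \<partial>distr M P tail)"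
    by (intro nn_integral_mono inner)
  also have "\<dots> = (\<integral>\<^sup>+x. ennreal (L (tail x) - gain d * (L (tail x))\<^sup>2) \<partial>M)"
    by (rule nn_integral_distr) measurable
  also have "\<dots> = ennreal (\<integral>x. L (tail x) - gain d * (L (tail x))\<^sup>2 \<partial>M)"
    using integrable_length[of \<theta> "Suc k" n] nonneg unfolding L_eq by (intro nn_integral_eq_integral) auto
  finally have "ennreal (\<integral>x. shadow_length d \<theta> (\<lambda>m. \<omega> (k + m) x) (Suc n) \<partial>M)
      \<le> ennreal (\<integral>x. L (tail x) - gain d * (L (tail x))\<^sup>2 \<partial>M)"
    using integrable_length shadow_length_bounds[OF d_pos] by (subst (asm) nn_integral_eq_integral) auto
  moreover have "0 \<le> (\<integral>x. L (tail x) - gain d * (L (tail x))\<^sup>2 \<partial>M)"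
    using nonneg by (intro integral_nonneg_AE) auto
  ultimately show ?thesis unfolding L_eq by simp
qed

text \<open>The shift \<open>k\<close> is arbitrary in the induction because the step uses the bound
  at \<open>Suc k\<close>. The trivial length bound 2 starts it, and
  \<open>C \<ge> 2 / gain d\<close> drives the step.\<close>

lemma expectation_length_le:
  assumes \<theta>: "\<theta> \<in> {0..pi}" and C: "C \<ge> 2" "C \<ge> 2 / gain d" and n: "n \<ge> 1"
  shows "(\<integral>x. shadow_length d \<theta> (\<lambda>m. \<omega> (k + m) x) n \<partial>M) \<le> C / real n"
  using n
proof (induction n arbitrary: k rule: nat_induct_at_least)
  case base
  have "(\<integral>x. shadow_length d \<theta> (\<lambda>m. \<omega> (k + m) x) 1 \<partial>M) \<le> (\<integral>x. 2 \<partial>M)"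
    using shadow_length_bounds[OF d_pos] by (intro integral_mono integrable_length) auto
  also have "\<dots> \<le> C / real 1" using C by (simp add: prob_space)
  finally show ?case .
next
  case (Suc n)
  let ?L = "\<lambda>x. shadow_length d \<theta> (\<lambda>m. \<omega> (Suc k + m) x) n"
  have "(\<integral>x. shadow_length d \<theta> (\<lambda>m. \<omega> (k + m) x) (Suc n) \<partial>M) \<le> (\<integral>x. ?L x - gain d * (?L x)\<^sup>2 \<partial>M)"
    by (rule expectation_length_Suc_le[OF \<theta>])
  also have "\<dots> \<le> expectation ?L - gain d * (expectation ?L)\<^sup>2"
    using gain_pos[OF d] by (intro integral_minus_square_le integrable_length) auto
  also have "\<dots> \<le> C / real (Suc n)"
    using Suc.hyps Suc.IH[of "Suc k"] shadow_length_bounds[OF d_pos]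
    by (intro quadratic_decay_step gain_pos[OF d] C integral_nonneg_AE) simp_all
  finally show ?case .
qed

section \<open>Favard length by Tonelli and Fatou\<close>

text \<open>Prepares for Tonelli: a nonnegative integral over \<open>lborel\<close> replaces the one
  over its completion. The bound 2 pi ensures that no infinite value is hidden by
  \<open>enn2real\<close>.\<close>

lemma ennreal_Fav:
  "ennreal (Fav (D d w n))
    = ennreal (1 / pi) * (\<integral>\<^sup>+\<theta>. ennreal (shadow_length d \<theta> w n) * indicator {0..pi} \<theta> \<partial>lborel)"
proof -
  have [measurable]: "(\<lambda>\<theta>. shadow_length d \<theta> w n) \<in> borel_measurable borel"
    by (intro borel_measurable_shadow_length d_pos) auto
  have "Fav (D d w n) = 1 / pi * (LINT \<theta>|lborel. indicator {0..pi} \<theta> * shadow_length d \<theta> w n)"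
    unfolding Fav_def line_length_shadow[OF d_pos] set_lebesgue_integral_def
    by (subst integral_completion) auto
  also have "(LINT \<theta>|lborel. indicator {0..pi} \<theta> * shadow_length d \<theta> w n)
      = enn2real (\<integral>\<^sup>+\<theta>. ennreal (shadow_length d \<theta> w n) * indicator {0..pi} \<theta> \<partial>lborel)"
    using shadow_length_bounds(1)[OF d_pos]
    by (subst integral_eq_nn_integral)
      (auto intro!: arg_cong[where f=enn2real] nn_integral_cong split: split_indicator)
  finally have F: "Fav (D d w n)
      = 1 / pi * enn2real (\<integral>\<^sup>+\<theta>. ennreal (shadow_length d \<theta> w n) * indicator {0..pi} \<theta> \<partial>lborel)" .
  have "(\<integral>\<^sup>+\<theta>. ennreal (shadow_length d \<theta> w n) * indicator {0..pi} \<theta> \<partial>lborel)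
      \<le> (\<integral>\<^sup>+\<theta>. ennreal 2 * indicator {0..pi} \<theta> \<partial>lborel)"
    using shadow_length_bounds[OF d_pos] by (intro nn_integral_mono mult_right_mono ennreal_leI) auto
  also have "\<dots> = ennreal (2 * pi)" by (simp add: nn_integral_cmult ennreal_mult')
  finally have "(\<integral>\<^sup>+\<theta>. ennreal (shadow_length d \<theta> w n) * indicator {0..pi} \<theta> \<partial>lborel) < top"
    by (rule le_less_trans) simp
  then show ?thesis unfolding F by (subst ennreal_mult') (auto simp: ennreal_enn2real)
qed

lemma Fav_nonneg: "0 \<le> Fav (D d w n)"
  unfolding Fav_def set_lebesgue_integral_def line_length_def by (intro mult_nonneg_nonneg integral_nonneg_AE) auto

lemma borel_measurable_length_angle:
  "(\<lambda>p. shadow_length d (snd p) (\<lambda>m. \<omega> m (fst p)) n) \<in> borel_measurable (M \<Otimes>\<^sub>M lborel)"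
  using measurable_angle by (intro borel_measurable_shadow_length d_pos measurable_compose[OF measurable_fst]) auto

lemma borel_measurable_Fav: "(\<lambda>x. Fav (D d (\<lambda>m. \<omega> m x) n)) \<in> borel_measurable M"
proof -
  note [measurable] = borel_measurable_length_angle
  have "(\<lambda>x. ennreal (1 / pi) * (\<integral>\<^sup>+\<theta>. ennreal (shadow_length d \<theta> (\<lambda>m. \<omega> m x) n) * indicator {0..pi} \<theta> \<partial>lborel))
      \<in> borel_measurable M"
    using lborel.borel_measurable_nn_integral_fst[of "\<lambda>p. ennreal (shadow_length d (snd p) (\<lambda>m. \<omega> m (fst p)) n) * indicator {0..pi} (snd p)" M]
    by simp
  then have "(\<lambda>x. ennreal (Fav (D d (\<lambda>m. \<omega> m x) n))) \<in> borel_measurable M"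
    unfolding ennreal_Fav .
  then have "(\<lambda>x. enn2real (ennreal (Fav (D d (\<lambda>m. \<omega> m x) n)))) \<in> borel_measurable M"
    by measurable
  then show ?thesis by (simp add: Fav_nonneg)
qed

text \<open>After exchanging expectation and integral, the bound holds for each direction, and the
  interval length pi cancels the factor 1/pi.\<close>

lemma nn_integral_Fav_le:
  assumes C: "C \<ge> 2" "C \<ge> 2 / gain d" and n: "n \<ge> 1"
  shows "(\<integral>\<^sup>+x. ennreal (Fav (D d (\<lambda>m. \<omega> m x) n)) \<partial>M) \<le> ennreal (C / real n)"
proof -
  interpret pair_sigma_finite M lborel ..
  note [measurable] = borel_measurable_length_angle
  let ?f = "\<lambda>x \<theta>. ennreal (shadow_length d \<theta> (\<lambda>m. \<omega> m x) n) * indicator {0..pi} \<theta>"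
  have [measurable]: "(\<lambda>x. \<integral>\<^sup>+\<theta>. ?f x \<theta> \<partial>lborel) \<in> borel_measurable M"
    using lborel.borel_measurable_nn_integral_fst[of "\<lambda>p. ?f (fst p) (snd p)" M] by simp
  have "(\<integral>\<^sup>+x. ennreal (Fav (D d (\<lambda>m. \<omega> m x) n)) \<partial>M)
      = ennreal (1 / pi) * (\<integral>\<^sup>+x. \<integral>\<^sup>+\<theta>. ?f x \<theta> \<partial>lborel \<partial>M)"
    unfolding ennreal_Fav by (rule nn_integral_cmult) measurable
  also have "(\<integral>\<^sup>+x. \<integral>\<^sup>+\<theta>. ?f x \<theta> \<partial>lborel \<partial>M) = (\<integral>\<^sup>+\<theta>. \<integral>\<^sup>+x. ?f x \<theta> \<partial>M \<partial>lborel)"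
    by (rule Fubini'[symmetric]) (simp add: split_beta')
  also have "\<dots> \<le> (\<integral>\<^sup>+\<theta>. ennreal (C / real n) * indicator {0..pi} \<theta> \<partial>lborel)"
  proof (intro nn_integral_mono)
    fix \<theta> :: real
    show "(\<integral>\<^sup>+x. ?f x \<theta> \<partial>M) \<le> ennreal (C / real n) * indicator {0..pi} \<theta>"
    proof (cases "\<theta> \<in> {0..pi}")
      case True
      have "(\<integral>\<^sup>+x. ?f x \<theta> \<partial>M) = ennreal (\<integral>x. shadow_length d \<theta> (\<lambda>m. \<omega> m x) n \<partial>M)"
        using True integrable_length(1)[of \<theta> 0 n] shadow_length_bounds[OF d_pos]
        by (simp add: nn_integral_eq_integral)
      also have "\<dots> \<le> ennreal (C / real n)"
        using expectation_length_le[OF True C n, of 0] by (intro ennreal_leI) simp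
      finally show ?thesis using True by simp
    qed simp
  qed
  also have "\<dots> = ennreal (C / real n * pi)"
    using C by (subst ennreal_mult) (simp_all add: nn_integral_cmult)
  also have "ennreal (1 / pi) * ennreal (C / real n * pi) = ennreal (C / real n)"
    by (simp add: ennreal_mult'[symmetric])
  finally show ?thesis by (simp add: mult_left_mono)
qed

lemma integrable_Fav:
  assumes n: "n \<ge> 1"
  shows "integrable M (\<lambda>x. Fav (D d (\<lambda>m. \<omega> m x) n))"
proof (rule integrableI_nonneg)
  have "(\<integral>\<^sup>+x. ennreal (Fav (D d (\<lambda>m. \<omega> m x) n)) \<partial>M) \<le> ennreal (max 2 (2 / gain d) / real n)"
    by (rule nn_integral_Fav_le) (use n in auto)
  also have "\<dots> < \<infinity>" by simp
  finally show "(\<integral>\<^sup>+x. ennreal (Fav (D d (\<lambda>m. \<omega> m x) n)) \<partial>M) < \<infinity>" .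
qed (simp_all add: borel_measurable_Fav Fav_nonneg)

lemma expectation_Fav_le:
  assumes C: "C \<ge> 2" "C \<ge> 2 / gain d" and n: "n \<ge> 1"
  shows "(\<integral>x. Fav (D d (\<lambda>m. \<omega> m x) n) \<partial>M) \<le> C / real n"
proof -
  have "ennreal (\<integral>x. Fav (D d (\<lambda>m. \<omega> m x) n) \<partial>M) \<le> ennreal (C / real n)"
    using nn_integral_Fav_le[OF assms] nn_integral_eq_integral[OF integrable_Fav[OF n]] Fav_nonneg by simp
  then show ?thesis using C by (simp add: ennreal_le_iff)
qed

text \<open>By Fatou the lower limit has integral at most \<open>C\<close>, so it is finite almost
  everywhere.\<close>

lemma AE_liminf_Fav: "AE x in M. liminf (\<lambda>n. ereal (real n * Fav (D d (\<lambda>m. \<omega> m x) n))) < \<infinity>"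
proof -
  note [measurable] = borel_measurable_Fav
  define C where "C = max 2 (2 / gain d)"
  have C: "C \<ge> 2" "C \<ge> 2 / gain d" by (simp_all add: C_def)
  let ?f = "\<lambda>n x. ennreal (real n * Fav (D d (\<lambda>m. \<omega> m x) n))"
  have bound: "(\<integral>\<^sup>+x. ?f n x \<partial>M) \<le> ennreal C" if "n \<ge> 1" for n
  proof -
    have "(\<integral>\<^sup>+x. ?f n x \<partial>M) = ennreal (real n) * (\<integral>\<^sup>+x. ennreal (Fav (D d (\<lambda>m. \<omega> m x) n)) \<partial>M)"
      by (subst nn_integral_cmult[symmetric]) (auto simp: ennreal_mult')
    also have "\<dots> \<le> ennreal (real n) * ennreal (C / real n)"
      by (intro mult_left_mono nn_integral_Fav_le C that) simp
    also have "\<dots> = ennreal C" using that by (simp add: ennreal_mult'[symmetric])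
    finally show ?thesis .
  qed
  have "(\<integral>\<^sup>+x. liminf (\<lambda>n. ?f n x) \<partial>M) \<le> liminf (\<lambda>n. \<integral>\<^sup>+x. ?f n x \<partial>M)"
    by (rule nn_integral_liminf) measurable
  also have "\<dots> \<le> ennreal C"
    by (intro Liminf_le) (use bound in \<open>auto simp: eventually_sequentially\<close>)
  finally have "(\<integral>\<^sup>+x. liminf (\<lambda>n. ?f n x) \<partial>M) \<noteq> \<infinity>"
    by (metis ennreal_neq_top infinity_ennreal_def top.extremum_unique)
  then have "AE x in M. liminf (\<lambda>n. ?f n x) \<noteq> \<infinity>"
    by (intro nn_integral_noteq_infinite) measurable
  then show ?thesis
  proof eventually_elim
    case (elim x)
    let ?u = "\<lambda>n. real n * Fav (D d (\<lambda>m. \<omega> m x) n)"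
    show ?case
    \<comment> \<open>Transfer from \<open>ennreal\<close> to \<open>ereal\<close>: an infinite
      lower limit means convergence to infinity, which \<open>e2ennreal\<close> preserves.\<close>
    proof (rule ccontr)
      assume "\<not> ?case"
      then have "(\<lambda>n. ereal (?u n)) \<longlonglongrightarrow> \<infinity>" by (simp add: Liminf_PInfty)
      then have "(\<lambda>n. e2ennreal (ereal (?u n))) \<longlonglongrightarrow> e2ennreal \<infinity>" by (rule tendsto_e2ennrealI)
      then have "(\<lambda>n. ?f n x) \<longlonglongrightarrow> \<infinity>" by (simp add: e2ennreal_ereal)
      then have "liminf (\<lambda>n. ?f n x) = \<infinity>" by (intro lim_imp_Liminf) auto
      with elim show False by simp
    qed
  qed
qed

end

theorem theorem2:
  fixes d :: nat
  assumes "d \<ge> 3"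
  shows "\<exists>C::real. C > 0 \<and>
    (\<forall>(M :: 'a measure) (\<omega> :: nat \<Rightarrow> 'a \<Rightarrow> real).
       prob_space M \<longrightarrow>
       prob_space.indep_vars M (\<lambda>_. borel) \<omega> {1..} \<longrightarrow>
       (\<forall>m\<ge>1. distr M borel (\<omega> m) = uniform_measure lborel {0..2 * pi / real d}) \<longrightarrow>
         (\<forall>\<theta>\<in>{0..pi}. \<forall>n\<ge>1.
            integrable M (\<lambda>x. line_length \<theta> (Proj \<theta> ` D d (\<lambda>m. \<omega> m x) n)) \<and>
            (\<integral>x. line_length \<theta> (Proj \<theta> ` D d (\<lambda>m. \<omega> m x) n) \<partial>M) \<le> C / real n) \<and>
         (\<forall>n\<ge>1.
            integrable M (\<lambda>x. Fav (D d (\<lambda>m. \<omega> m x) n)) \<and>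
            (\<integral>x. Fav (D d (\<lambda>m. \<omega> m x) n) \<partial>M) \<le> C / real n) \<and>
         (AE x in M. liminf (\<lambda>n. ereal (real n * Fav (D d (\<lambda>m. \<omega> m x) n))) < \<infinity>))"
proof (intro exI conjI allI impI)
  \<comment> \<open>The term 2 serves the case n = 1, the term 2 / \<open>gain d\<close> the
    recursion; both depend on \<open>d\<close> alone.\<close>
  let ?C = "max 2 (2 / gain d)"
  show "?C > 0" by simp
  fix M :: "'a measure" and \<omega> :: "nat \<Rightarrow> 'a \<Rightarrow> real"
  assume M: "prob_space M" and indep: "prob_space.indep_vars M (\<lambda>_. borel) \<omega> {1..}"
    and distr: "\<forall>m\<ge>1. distr M borel (\<omega> m) = uniform_measure lborel {0..2 * pi / real d}"
  interpret prob_space M by (rule M)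
  interpret random_angles M d \<omega> by unfold_locales (use assms indep distr in auto)
  have d0: "d > 0" using assms by simp
  show "\<forall>\<theta>\<in>{0..pi}. \<forall>n\<ge>1.
      integrable M (\<lambda>x. line_length \<theta> (Proj \<theta> ` D d (\<lambda>m. \<omega> m x) n)) \<and>
      (\<integral>x. line_length \<theta> (Proj \<theta> ` D d (\<lambda>m. \<omega> m x) n) \<partial>M) \<le> ?C / real n"
    unfolding line_length_shadow[OF d0]
    using integrable_length(1)[of _ 0] expectation_length_le[of _ ?C _ 0] by simp
  show "integrable M (\<lambda>x. Fav (D d (\<lambda>m. \<omega> m x) n))" if "n \<ge> 1" for n
    using that by (rule integrable_Fav)
  show "(\<integral>x. Fav (D d (\<lambda>m. \<omega> m x) n) \<partial>M) \<le> ?C / real n" if "n \<ge> 1" for n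
    using that by (intro expectation_Fav_le) auto
  show "AE x in M. liminf (\<lambda>n. ereal (real n * Fav (D d (\<lambda>m. \<omega> m x) n))) < \<infinity>"
    by (rule AE_liminf_Fav)
qed

end
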